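(* Let $0<p\le 1$, $q>1$, let $\bm{A}\in\mathbb{R}^{m\times n}$, and let $s$ be a positive integer. Let $\bm{x}_0\in\mathbb{R}^n\setminus\{\bm{0}\}$ be an $s$-sparse vector and set $\bm{b}=\bm{A}\bm{x}_0$. Assume that $\bm{A}$ satisfies the $\ell_p$ null space property of order $s$ with a constant $\mu\in(0,1)$. If $p=1$, assume in addition that $$\mu\le\frac{1}{1+\kappa_{1,q}(\bm{x}_0)};$$ if $0<p<1$, no further restriction on $\mu$ is imposed. Then $\bm{x}_0$ is a strict local minimizer of $\bm{x}\mapsto \|\bm{x}\|_p^p/\|\bm{x}\|_q^p$ over the feasible set $\{\bm{x}\in\mathbb{R}^n\setminus\{\bm 0\}:\bm{A}\bm{x}=\bm{b}\}$; that is, there is $\delta_r>0$ such that for every $\bm{h}\in\ker(\bm{A})\setminus\{\bm{0}\}$ with $\|\bm{h}\|_\infty\le\delta_r$, $$\frac{\|\bm{x}_0+\bm{h}\|_p^p}{\|\bm{x}_0+\bm{h}\|_q^p}>\frac{\|\bm{x}_0\|_p^p}{\|\bm{x}_0\|_q^p}.$$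
   Context: For $0<r<\infty$, $\|\bm{u}\|_r:=(\sum_i|u_i|^r)^{1/r}$ (a quasi-norm if $r<1$), and $\|\bm{u}\|_\infty:=\max_i|u_i|$. A vector is $s$-sparse if it has at most $s$ nonzero entries. For $\mathcal{S}\subseteq[n]=\{1,\dots,n\}$, $\bm{v}_{\mathcal{S}}$ is the vector agreeing with $\bm{v}$ on $\mathcal{S}$ and zero elsewhere; $\mathcal{S}^c=[n]\setminus\mathcal{S}$. $\ell_p$ null space property ($0<p\le1$) of order $s$ with constant $\mu\in(0,1)$: $\|\bm{v}_{\mathcal{S}}\|_p^p<\mu\|\bm{v}_{\mathcal{S}^c}\|_p^p$ for every $\bm{v}\in\ker(\bm{A})\setminus\{\bm{0}\}$ and every $\mathcal{S}\subseteq[n]$ with $\operatorname{card}(\mathcal{S})\le s$. Generalized norm-ratio coefficient of a nonzero vector: $\kappa_{p,q}(\bm{x}_0):=\dfrac{\|\bm{x}_0\|_p^p\,\|\bm{x}_0\|_\infty^{q-p}}{\|\bm{x}_0\|_q^q}$; in particular $\kappa_{1,q}(\bm{x}_0)=\|\bm{x}_0\|_1\|\bm{x}_0\|_\infty^{q-1}/\|\bm{x}_0\|_q^q$. *)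

theory Defs
  imports "HOL-Analysis.Analysis"
begin

text \<open>The norms with finite exponent (quasi-norms below exponent 1). Since
  \<^term>\<open>0 powr r = (0::real)\<close> for every \<open>r\<close>, zero entries contribute nothing.
  The maximum norm is \<^const>\<open>infnorm\<close>.\<close>

definition lp_norm :: "real \<Rightarrow> real ^ 'n \<Rightarrow> real" where
  "lp_norm r u = (\<Sum>i\<in>UNIV. \<bar>u $ i\<bar> powr r) powr (1 / r)"

definition sparse_vec :: "nat \<Rightarrow> real ^ 'n \<Rightarrow> bool" where
  "sparse_vec s x \<longleftrightarrow> card {i. x $ i \<noteq> 0} \<le> s"

definition restrict_vec :: "'n set \<Rightarrow> real ^ 'n \<Rightarrow> real ^ 'n" where
  "restrict_vec S v = (\<chi> i. if i \<in> S then v $ i else 0)"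

definition null_space_property ::
  "real \<Rightarrow> nat \<Rightarrow> real \<Rightarrow> real ^ 'n ^ 'm \<Rightarrow> bool" where
  "null_space_property p s \<mu> A \<longleftrightarrow>
     (\<forall>v. A *v v = 0 \<and> v \<noteq> 0 \<longrightarrow>
       (\<forall>S. card S \<le> s \<longrightarrow>
         lp_norm p (restrict_vec S v) powr p < \<mu> * lp_norm p (restrict_vec (- S) v) powr p))"

definition norm_ratio_coeff :: "real \<Rightarrow> real \<Rightarrow> real ^ 'n \<Rightarrow> real" where
  "norm_ratio_coeff p q x = lp_norm p x powr p * infnorm x powr (q - p) / lp_norm q x powr q"

definition strict_local_minimizer_on ::
  "('a :: topological_space \<Rightarrow> real) \<Rightarrow> 'a set \<Rightarrow> 'a \<Rightarrow> bool" where
  "strict_local_minimizer_on f X x \<longleftrightarrow>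
     x \<in> X \<and> (\<forall>\<^sub>F y in at x within X. f x < f y)"

end

theory Submission
  imports Defs
begin

text \<open>
  Write \<open>N\<close> and \<open>Q\<close> for the sums of the \<open>p\<close>-th and \<open>q\<close>-th powers of the absolute
  entries of \<open>x\<^sub>0 + h\<close>, and \<open>N\<^sub>0\<close>, \<open>Q\<^sub>0\<close> for those of \<open>x\<^sub>0\<close>. Since \<open>p / q < 1\<close>, concavity gives
  \<open>(Q / Q\<^sub>0) powr (p / q) \<le> 1 + p / q * (Q / Q\<^sub>0 - 1)\<close>, so it suffices to show
  \<open>N - N\<^sub>0 > c * (Q - Q\<^sub>0)\<close> for \<open>c = p * N\<^sub>0 / (q * Q\<^sub>0)\<close>, which is a sum over the
  coordinates. For small \<open>h\<close> a coordinate outside the support of \<open>x\<^sub>0\<close> contributes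
  at least \<open>\<theta> * \<mu> * \<bar>h $ i\<bar> powr p\<close> whenever \<open>\<theta> * \<mu> < 1\<close>. On the support the summand is
  differentiable: if \<open>p < 1\<close> it is \<open>o(\<bar>h $ i\<bar> powr p)\<close>, and if \<open>p = 1\<close> its slope is bounded by
  \<open>max 1 \<kappa> < 1 + \<kappa> \<le> 1 / \<mu>\<close>. In both cases some such \<open>\<theta>\<close> makes it at least
  \<open>- \<theta> * \<bar>h $ i\<bar> powr p\<close>, and the null space property concludes.
\<close>

text \<open>Weighted arithmetic-geometric mean of \<open>z\<close> and \<open>1\<close> with weights
  \<open>a\<close> and \<open>1 - a\<close>. The case \<open>z = 0\<close> reads
  \<open>0 \<le> 1 - a\<close>.\<close>

lemma powr_le_tangent:
  fixes a z :: real
  assumes "0 < a" "a < 1" "0 \<le> z"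
  shows "z powr a \<le> 1 + a * (z - 1)"
  using Youngs_inequality_0[of a "1 - a" z 1] assms
  by (cases "z = 0") (simp_all add: algebra_simps)

lemma lp_norm_powr:
  assumes "0 < r"
  shows "lp_norm r x powr t = (\<Sum>i\<in>UNIV. \<bar>x $ i\<bar> powr r) powr (t / r)"
  using assms by (simp add: lp_norm_def powr_powr)

lemma lp_norm_powr_self:
  assumes "0 < r"
  shows "lp_norm r x powr r = (\<Sum>i\<in>UNIV. \<bar>x $ i\<bar> powr r)"
  using assms by (simp add: lp_norm_powr sum_nonneg)

lemma sum_abs_powr_pos:
  fixes x :: "real ^ 'n"
  assumes "x \<noteq> 0"
  shows "0 < (\<Sum>i\<in>UNIV. \<bar>x $ i\<bar> powr r)"
proof -
  obtain i where "x $ i \<noteq> 0" using assms by (auto simp: vec_eq_iff)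
  then show ?thesis by (intro sum_pos2[of _ i]) auto
qed

lemma lp_norm_restrict_vec_powr:
  fixes v :: "real ^ 'n"
  assumes "0 < r"
  shows "lp_norm r (restrict_vec S v) powr r = (\<Sum>i\<in>S. \<bar>v $ i\<bar> powr r)"
proof -
  have "(\<Sum>i\<in>UNIV. \<bar>restrict_vec S v $ i\<bar> powr r)
      = (\<Sum>i\<in>UNIV. if i \<in> S then \<bar>v $ i\<bar> powr r else 0)"
    by (rule sum.cong) (auto simp: restrict_vec_def)
  also have "\<dots> = (\<Sum>i\<in>S. \<bar>v $ i\<bar> powr r)"
    by (simp add: sum.If_cases)
  finally show ?thesis using assms by (simp add: lp_norm_powr_self)
qed

text \<open>For \<open>\<bar>u\<bar> < \<bar>a\<bar>\<close> the sum \<open>a + u\<close> keeps the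
  sign of \<open>a\<close>, so the absolute value becomes the linear factor
  \<open>sgn a * (a + u)\<close>.\<close>

lemma has_real_derivative_abs_shift_powr:
  fixes a r :: real
  assumes "a \<noteq> 0"
  shows "((\<lambda>u. \<bar>a + u\<bar> powr r) has_real_derivative sgn a * (r * \<bar>a\<bar> powr (r - 1))) (at 0)"
proof (rule has_field_derivative_transform_within[where d = "\<bar>a\<bar>"])
  show "((\<lambda>u. (sgn a * (a + u)) powr r) has_real_derivative sgn a * (r * \<bar>a\<bar> powr (r - 1))) (at 0)"
    using assms by (auto intro!: derivative_eq_intros simp: sgn_if)
  show "(sgn a * (a + u)) powr r = \<bar>a + u\<bar> powr r" if "dist u 0 < \<bar>a\<bar>" for u
    using that by (auto simp: sgn_if dist_real_def)
qed (use assms in auto)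

lemma eventually_abs_le_of_real_derivative:
  fixes g :: "real \<Rightarrow> real"
  assumes "(g has_real_derivative D) (at 0)" "g 0 = 0" "\<bar>D\<bar> < K"
  shows "\<forall>\<^sub>F u in nhds 0. \<bar>g u\<bar> \<le> K * \<bar>u\<bar>"
proof -
  have "((\<lambda>u. \<bar>g u / u\<bar>) \<longlongrightarrow> \<bar>D\<bar>) (at 0)"
    using assms(1,2) by (intro tendsto_rabs) (simp add: has_field_derivative_iff)
  then have "\<forall>\<^sub>F u in at 0. \<bar>g u / u\<bar> < K"
    using assms(3) by (rule order_tendstoD)
  then have "\<forall>\<^sub>F u in at 0. \<bar>g u\<bar> \<le> K * \<bar>u\<bar>"
    by (rule eventually_mono[OF eventually_conj[OF _ eventually_neq_at_within[of 0]]])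
      (auto simp: abs_divide field_simps)
  then show ?thesis
    using assms(2) by (simp add: eventually_nhds_conv_at)
qed

text \<open>Dividing by \<open>\<bar>u\<bar> powr r\<close> leaves
  \<open>K * \<bar>u\<bar> powr (t - r)\<close>, which tends to 0. At \<open>u = 0\<close> both
  sides vanish.\<close>

lemma eventually_mult_abs_powr_le:
  fixes K \<epsilon> r t :: real
  assumes "0 < \<epsilon>" "r < t"
  shows "\<forall>\<^sub>F u in nhds (0::real). K * \<bar>u\<bar> powr t \<le> \<epsilon> * \<bar>u\<bar> powr r"
proof -
  have "((\<lambda>u::real. K * \<bar>u\<bar> powr (t - r)) \<longlongrightarrow> K * 0) (at 0)"
    by (intro tendsto_mult tendsto_const tendsto_zero_powrI[where b = "t - r"])
      (use assms in \<open>auto intro!: tendsto_eq_intros\<close>)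
  then have "\<forall>\<^sub>F u::real in at 0. K * \<bar>u\<bar> powr (t - r) < \<epsilon>"
    by (rule order_tendstoD) (use assms in simp)
  then have "\<forall>\<^sub>F u::real in at 0. K * \<bar>u\<bar> powr t \<le> \<epsilon> * \<bar>u\<bar> powr r"
  proof (rule eventually_mono)
    fix u :: real assume "K * \<bar>u\<bar> powr (t - r) < \<epsilon>"
    then have "K * \<bar>u\<bar> powr (t - r) * \<bar>u\<bar> powr r \<le> \<epsilon> * \<bar>u\<bar> powr r"
      by (intro mult_right_mono) auto
    then show "K * \<bar>u\<bar> powr t \<le> \<epsilon> * \<bar>u\<bar> powr r"
      by (simp add: mult.assoc flip: powr_add)
  qed
  then show ?thesis by (simp add: eventually_nhds_conv_at)
qed

text \<open>The contribution of one coordinate to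
  \<open>(N - N\<^sub>0) - c * (Q - Q\<^sub>0)\<close>, with \<open>a\<close> the entry of
  \<open>x\<^sub>0\<close> and \<open>u\<close> that of the perturbation.\<close>

definition gap :: "real \<Rightarrow> real \<Rightarrow> real \<Rightarrow> real \<Rightarrow> real \<Rightarrow> real" where
  "gap p q c a u = (\<bar>a + u\<bar> powr p - \<bar>a\<bar> powr p) - c * (\<bar>a + u\<bar> powr q - \<bar>a\<bar> powr q)"

text \<open>At \<open>a = 0\<close> the gap is
  \<open>\<bar>u\<bar> powr p - c * \<bar>u\<bar> powr q\<close>; the spare share
  \<open>1 - \<eta>\<close> of the first term absorbs the second.\<close>

lemma gap_off_support:
  assumes "p < q" "\<eta> < 1"
  shows "\<forall>\<^sub>F u in nhds 0. \<eta> * \<bar>u\<bar> powr p \<le> gap p q c 0 u"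
  using eventually_mult_abs_powr_le[of "1 - \<eta>" p q c] assms
  by (auto elim!: eventually_mono simp: gap_def algebra_simps)

text \<open>The second assumption bounds the modulus of the derivative at \<open>u = 0\<close>; the
  common factor \<open>sgn a\<close> drops out.\<close>

lemma gap_on_support:
  assumes "a \<noteq> 0" "\<bar>p * \<bar>a\<bar> powr (p - 1) - c * (q * \<bar>a\<bar> powr (q - 1))\<bar> < K"
  shows "\<forall>\<^sub>F u in nhds 0. \<bar>gap p q c a u\<bar> \<le> K * \<bar>u\<bar>"
proof (rule eventually_abs_le_of_real_derivative)
  show "(gap p q c a has_real_derivative
      sgn a * (p * \<bar>a\<bar> powr (p - 1)) - c * (sgn a * (q * \<bar>a\<bar> powr (q - 1)))) (at 0)"
    unfolding gap_def [abs_def]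
    by (rule DERIV_cong, (rule DERIV_diff DERIV_cmult DERIV_const
          has_real_derivative_abs_shift_powr assms(1))+) simp
  have "sgn a * (p * \<bar>a\<bar> powr (p - 1)) - c * (sgn a * (q * \<bar>a\<bar> powr (q - 1)))
      = sgn a * (p * \<bar>a\<bar> powr (p - 1) - c * (q * \<bar>a\<bar> powr (q - 1)))"
    by (simp add: algebra_simps)
  then show "\<bar>sgn a * (p * \<bar>a\<bar> powr (p - 1)) - c * (sgn a * (q * \<bar>a\<bar> powr (q - 1)))\<bar> < K"
    using assms by (simp add: abs_mult abs_sgn_eq)
qed (simp add: gap_def)

text \<open>Differentiability makes the gap at most linear in \<open>\<bar>u\<bar>\<close>, and for
  \<open>p < 1\<close> the power \<open>\<bar>u\<bar> powr p\<close> dominates any multiple of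
  \<open>\<bar>u\<bar>\<close>.\<close>

lemma gap_on_support_less_one:
  assumes "a \<noteq> 0" "p < 1"
  shows "\<forall>\<^sub>F u in nhds 0. - (\<bar>u\<bar> powr p) \<le> gap p q c a u"
proof -
  define K where "K = \<bar>p * \<bar>a\<bar> powr (p - 1) - c * (q * \<bar>a\<bar> powr (q - 1))\<bar> + 1"
  have "\<forall>\<^sub>F u in nhds 0. \<bar>gap p q c a u\<bar> \<le> K * \<bar>u\<bar>"
    by (rule gap_on_support) (use assms in \<open>auto simp: K_def\<close>)
  moreover have "\<forall>\<^sub>F u in nhds (0::real). K * \<bar>u\<bar> powr 1 \<le> 1 * \<bar>u\<bar> powr p"
    by (rule eventually_mult_abs_powr_le) (use assms in auto)
  ultimately show ?thesis
    by eventually_elim auto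
qed

lemma ratio_increases:
  fixes x y :: "real ^ 'n"
  assumes "0 < p" "p < q" "x \<noteq> 0"
    and c: "c = p * (\<Sum>i\<in>UNIV. \<bar>x $ i\<bar> powr p) / (q * (\<Sum>i\<in>UNIV. \<bar>x $ i\<bar> powr q))"
    and pos: "0 < (\<Sum>i\<in>UNIV. gap p q c (x $ i) (h $ i))"
  shows "lp_norm p x powr p / lp_norm q x powr p
       < lp_norm p (x + h) powr p / lp_norm q (x + h) powr p"
proof -
  define N where "N = (\<lambda>z :: real ^ 'n. \<Sum>i\<in>UNIV. \<bar>z $ i\<bar> powr p)"
  define Q where "Q = (\<lambda>z :: real ^ 'n. \<Sum>i\<in>UNIV. \<bar>z $ i\<bar> powr q)"
  have N0: "0 < N x" and Q0: "0 < Q x"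
    using sum_abs_powr_pos[OF assms(3)] by (auto simp: N_def Q_def)
  have Qnn: "0 \<le> Q (x + h)" by (simp add: Q_def sum_nonneg)
  have "(\<Sum>i\<in>UNIV. gap p q c (x $ i) (h $ i)) = (N (x + h) - N x) - c * (Q (x + h) - Q x)"
    by (simp add: gap_def N_def Q_def sum_subtractf flip: sum_distrib_left)
  then have "N x + c * (Q (x + h) - Q x) < N (x + h)" using pos by simp
  \<comment> \<open>The choice of \<open>c\<close> turns the affine expression into
    \<open>N x\<close> times the tangent at 1 of \<open>z powr (p / q)\<close>.\<close>
  moreover have "N x + c * (Q (x + h) - Q x) = N x * (1 + p / q * (Q (x + h) / Q x - 1))"
  proof -
    have "c = p * N x / (q * Q x)" by (simp add: c N_def Q_def)
    moreover have "Q x \<noteq> 0" "q \<noteq> 0" using Q0 assms(1,2) by auto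
    ultimately show ?thesis by (simp only:) (simp add: divide_simps algebra_simps)
  qed
  moreover have "N x * (Q (x + h) / Q x) powr (p / q)
      \<le> N x * (1 + p / q * (Q (x + h) / Q x - 1))"
    using N0 Q0 Qnn assms(1,2) by (intro mult_left_mono powr_le_tangent) auto
  ultimately have less: "N x * (Q (x + h) / Q x) powr (p / q) < N (x + h)" by simp
  \<comment> \<open>This secures a positive denominator: division by zero yields 0 here and would
    spoil the final ratio.\<close>
  have "x + h \<noteq> 0"
  proof
    assume "x + h = 0"
    then have "N (x + h) = 0" by (simp add: N_def)
    moreover have "0 \<le> N x * (Q (x + h) / Q x) powr (p / q)" using N0 by simp
    ultimately show False using less by simp
  qed
  then have "0 < Q (x + h)" unfolding Q_def by (rule sum_abs_powr_pos)
  then have "N x / Q x powr (p / q) < N (x + h) / Q (x + h) powr (p / q)"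
    using less Q0 by (simp add: powr_divide field_simps)
  then show ?thesis
    using assms(1,2) by (simp add: lp_norm_powr N_def Q_def sum_nonneg)
qed

theorem theorem3p2:
  fixes A :: "real ^ 'n ^ 'm" and x\<^sub>0 :: "real ^ 'n" and b :: "real ^ 'm"
    and p q \<mu> :: real and s :: nat
  assumes "0 < p" and "p \<le> 1" and "1 < q" and "0 < s"
    and "x\<^sub>0 \<noteq> 0" and "sparse_vec s x\<^sub>0" and "b = A *v x\<^sub>0"
    and "0 < \<mu>" and "\<mu> < 1" and "null_space_property p s \<mu> A"
    and "p = 1 \<Longrightarrow> \<mu> \<le> 1 / (1 + norm_ratio_coeff 1 q x\<^sub>0)"
  shows "strict_local_minimizer_on (\<lambda>x. lp_norm p x powr p / lp_norm q x powr p)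
           {x. x \<noteq> 0 \<and> A *v x = b} x\<^sub>0
       \<and> (\<exists>\<delta>>0. \<forall>h. A *v h = 0 \<and> h \<noteq> 0 \<and> infnorm h \<le> \<delta> \<longrightarrow>
            lp_norm p (x\<^sub>0 + h) powr p / lp_norm q (x\<^sub>0 + h) powr p
              > lp_norm p x\<^sub>0 powr p / lp_norm q x\<^sub>0 powr p)"
proof -
  define N\<^sub>0 where "N\<^sub>0 = (\<Sum>i\<in>UNIV. \<bar>x\<^sub>0 $ i\<bar> powr p)"
  define Q\<^sub>0 where "Q\<^sub>0 = (\<Sum>i\<in>UNIV. \<bar>x\<^sub>0 $ i\<bar> powr q)"
  define c where "c = p * N\<^sub>0 / (q * Q\<^sub>0)"
  define S where "S = {i. x\<^sub>0 $ i \<noteq> 0}"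
  have N0: "0 < N\<^sub>0" and Q0: "0 < Q\<^sub>0"
    using sum_abs_powr_pos[OF \<open>x\<^sub>0 \<noteq> 0\<close>] by (auto simp: N\<^sub>0_def Q\<^sub>0_def)
  have "\<exists>\<theta>>0. \<theta> * \<mu> < 1 \<and>
      (\<forall>i\<in>S. \<forall>\<^sub>F u in nhds 0. - \<theta> * \<bar>u\<bar> powr p \<le> gap p q c (x\<^sub>0 $ i) u)"
  proof (cases "p = 1")
    case False
    then have "p < 1" using \<open>p \<le> 1\<close> by simp
    then show ?thesis
      using gap_on_support_less_one \<open>\<mu> < 1\<close> by (intro exI[of _ 1]) (auto simp: S_def)
  next
    case True
    define \<kappa> where "\<kappa> = norm_ratio_coeff 1 q x\<^sub>0"
    have \<kappa>: "\<kappa> = N\<^sub>0 / Q\<^sub>0 * infnorm x\<^sub>0 powr (q - 1)"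
      using \<open>1 < q\<close> unfolding \<kappa>_def norm_ratio_coeff_def N\<^sub>0_def Q\<^sub>0_def True
      by (subst (1 2) lp_norm_powr_self) simp_all
    have "0 < \<kappa>"
      using N0 Q0 \<open>x\<^sub>0 \<noteq> 0\<close> by (simp add: \<kappa> infnorm_eq_0)
    \<comment> \<open>The lower bound will dominate the slope on the support, the upper one gives
      \<open>\<theta> * \<mu> < 1\<close>. There is room between them because
      \<open>\<kappa> > 0\<close>.\<close>
    then obtain \<theta> where \<theta>: "max 1 \<kappa> < \<theta>" "\<theta> < 1 + \<kappa>"
      using dense[of "max 1 \<kappa>" "1 + \<kappa>"] by auto
    have "\<mu> * (1 + \<kappa>) \<le> 1"
      using assms(11)[OF True] \<open>0 < \<kappa>\<close> by (simp add: \<kappa>_def field_simps)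
    then have "\<theta> * \<mu> < 1"
      using mult_strict_left_mono[OF \<theta>(2) \<open>0 < \<mu>\<close>]
      by (simp only: mult.commute[of \<theta>])
    moreover have "\<forall>\<^sub>F u in nhds 0. - \<theta> * \<bar>u\<bar> powr p \<le> gap p q c (x\<^sub>0 $ i) u" if "i \<in> S" for i
    proof -
      have "c * (q * \<bar>x\<^sub>0 $ i\<bar> powr (q - 1)) = N\<^sub>0 / Q\<^sub>0 * \<bar>x\<^sub>0 $ i\<bar> powr (q - 1)"
        using \<open>1 < q\<close> True by (simp add: c_def)
      moreover have "\<dots> \<le> \<kappa>"
        unfolding \<kappa> using N0 Q0 \<open>1 < q\<close>
        by (intro mult_left_mono powr_mono2 component_le_infnorm_cart) auto
      moreover have "0 \<le> N\<^sub>0 / Q\<^sub>0 * \<bar>x\<^sub>0 $ i\<bar> powr (q - 1)"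
        using N0 Q0 by simp
      moreover have "p * \<bar>x\<^sub>0 $ i\<bar> powr (p - 1) = 1"
        using that True by (simp add: S_def)
      \<comment> \<open>The slope has the form \<open>1 - t\<close> with
        \<open>0 \<le> t \<le> \<kappa>\<close>, so its modulus is at most
        \<open>max 1 \<kappa>\<close>.\<close>
      ultimately have "\<bar>p * \<bar>x\<^sub>0 $ i\<bar> powr (p - 1) - c * (q * \<bar>x\<^sub>0 $ i\<bar> powr (q - 1))\<bar> < \<theta>"
        using \<theta>(1) by linarith
      then have "\<forall>\<^sub>F u in nhds 0. \<bar>gap p q c (x\<^sub>0 $ i) u\<bar> \<le> \<theta> * \<bar>u\<bar>"
        using that by (intro gap_on_support) (auto simp: S_def)
      then show ?thesis
        by (rule eventually_mono) (auto simp: True)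
    qed
    ultimately show ?thesis
      using \<theta>(1) by (intro exI[of _ \<theta>]) auto
  qed
  then obtain \<theta> where \<theta>: "0 < \<theta>" "\<theta> * \<mu> < 1"
    and on: "\<And>i. i \<in> S \<Longrightarrow> \<forall>\<^sub>F u in nhds 0. - \<theta> * \<bar>u\<bar> powr p \<le> gap p q c (x\<^sub>0 $ i) u"
    by blast
  have off: "\<forall>\<^sub>F u in nhds 0. \<theta> * \<mu> * \<bar>u\<bar> powr p \<le> gap p q c (x\<^sub>0 $ i) u" if "i \<notin> S" for i
    using gap_off_support[of p q "\<theta> * \<mu>" c] that \<theta> assms(2,3) by (simp add: S_def)
  have "\<forall>\<^sub>F u in nhds 0. (if i \<in> S then - \<theta> else \<theta> * \<mu>) * \<bar>u\<bar> powr p \<le> gap p q c (x\<^sub>0 $ i) u" for i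
    using on off by (cases "i \<in> S") auto
  \<comment> \<open>Finitely many coordinates share one neighbourhood, hence one radius
    \<open>d\<close>.\<close>
  then have "\<forall>\<^sub>F u in nhds 0. \<forall>i.
      (if i \<in> S then - \<theta> else \<theta> * \<mu>) * \<bar>u\<bar> powr p \<le> gap p q c (x\<^sub>0 $ i) u"
    by (rule eventually_all_finite)
  then obtain d where "0 < d" and d: "\<And>u i. \<bar>u\<bar> < d \<Longrightarrow>
      (if i \<in> S then - \<theta> else \<theta> * \<mu>) * \<bar>u\<bar> powr p \<le> gap p q c (x\<^sub>0 $ i) u"
    unfolding eventually_nhds_metric dist_real_def by auto
  have key: "lp_norm p x\<^sub>0 powr p / lp_norm q x\<^sub>0 powr p
      < lp_norm p (x\<^sub>0 + h) powr p / lp_norm q (x\<^sub>0 + h) powr p"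
    if h: "A *v h = 0" "h \<noteq> 0" "infnorm h \<le> d / 2" for h
  proof (rule ratio_increases)
    have "\<bar>h $ i\<bar> < d" for i
      using component_le_infnorm_cart[of h i] h(3) \<open>0 < d\<close> by linarith
    then have "(\<Sum>i\<in>UNIV. (if i \<in> S then - \<theta> else \<theta> * \<mu>) * \<bar>h $ i\<bar> powr p)
        \<le> (\<Sum>i\<in>UNIV. gap p q c (x\<^sub>0 $ i) (h $ i))"
      by (intro sum_mono d)
    \<comment> \<open>The weights are chosen so that the lower bound is \<open>\<theta>\<close>
      times the slack in the null space inequality for \<open>h\<close> and
      \<open>S\<close>.\<close>
    moreover have "(\<Sum>i\<in>UNIV. (if i \<in> S then - \<theta> else \<theta> * \<mu>) * \<bar>h $ i\<bar> powr p)
        = \<theta> * (\<mu> * (\<Sum>i\<in>- S. \<bar>h $ i\<bar> powr p) - (\<Sum>i\<in>S. \<bar>h $ i\<bar> powr p))"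
    proof -
      have "(\<Sum>i\<in>UNIV. (if i \<in> S then - \<theta> else \<theta> * \<mu>) * \<bar>h $ i\<bar> powr p)
          = (\<Sum>i\<in>UNIV. if i \<in> S then - \<theta> * \<bar>h $ i\<bar> powr p else \<theta> * \<mu> * \<bar>h $ i\<bar> powr p)"
        by (rule sum.cong) auto
      then show ?thesis
        by (simp add: sum.If_cases sum_negf right_diff_distrib mult.assoc Compl_eq
            flip: sum_distrib_left)
    qed
    moreover have "(\<Sum>i\<in>S. \<bar>h $ i\<bar> powr p) < \<mu> * (\<Sum>i\<in>- S. \<bar>h $ i\<bar> powr p)"
      using assms(1,6,10) h(1,2)
      by (simp add: null_space_property_def sparse_vec_def S_def lp_norm_restrict_vec_powr)
    ultimately show "0 < (\<Sum>i\<in>UNIV. gap p q c (x\<^sub>0 $ i) (h $ i))"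
      using \<theta>(1) by (smt (verit) mult_pos_pos)
  qed (use assms in \<open>auto simp: c_def N\<^sub>0_def Q\<^sub>0_def\<close>)
  have "\<forall>\<^sub>F y in at x\<^sub>0 within {x. x \<noteq> 0 \<and> A *v x = b}.
      lp_norm p x\<^sub>0 powr p / lp_norm q x\<^sub>0 powr p < lp_norm p y powr p / lp_norm q y powr p"
    unfolding eventually_at
  proof (intro exI[of _ "d / 2"] conjI ballI impI)
    fix y assume y: "y \<in> {x. x \<noteq> 0 \<and> A *v x = b}" "y \<noteq> x\<^sub>0 \<and> dist y x\<^sub>0 < d / 2"
    \<comment> \<open>The filter uses Euclidean distance, which dominates \<open>infnorm\<close>, so
      the same radius serves both claims.\<close>
    have "infnorm (y - x\<^sub>0) \<le> d / 2"
      using infnorm_le_norm[of "y - x\<^sub>0"] y(2) by (simp add: dist_norm)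
    then show "lp_norm p x\<^sub>0 powr p / lp_norm q x\<^sub>0 powr p < lp_norm p y powr p / lp_norm q y powr p"
      using key[of "y - x\<^sub>0"] y \<open>b = A *v x\<^sub>0\<close> by (simp add: matrix_vector_mult_diff_distrib)
  qed (use \<open>0 < d\<close> in simp)
  then show ?thesis
    using key \<open>0 < d\<close> assms(5,7)
    by (auto simp: strict_local_minimizer_on_def intro!: exI[of _ "d / 2"])
qed

end
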